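(* Let $n\ge 2$, $r>n-1$, and let $\tilde b\in\mathbb{R}^n$ be a constant vector satisfying the Diophantine condition: there is a constant $c>0$ such that $|\tilde b\cdot k|\ge c|k|^{-r}$ for all $k\in\mathbb{Z}^n\setminus\{0\}$. Let $m\ge 0$ and let $(U_0,B_0)\in H^m(\mathbb{T}^n)$ satisfy $$\int_{\mathbb{T}^n}U_0\,dx=0,\qquad \int_{\mathbb{T}^n}B_0\,dx=0.$$ Let $(U,B)$ be the corresponding solution of the linear system $$\begin{cases}\partial_t U=\tilde b\cdot\nabla B,\\ \partial_t B-\Delta B=\tilde b\cdot\nabla U,\\ \nabla\cdot U=\nabla\cdot B=0,\\ U(x,0)=U_0(x),\quad B(x,0)=B_0(x),\end{cases}$$ on $\mathbb{T}^n\times[0,\infty)$. Then for any $s\in[0,m]$ there is a constant $C>0$, independent of $t$ and of the initial data, such that for all $t\ge 0$ $$\|U(t)\|_{H^s}\le C(1+t)^{-\frac{m-s}{2(1+r)}}\|(U_0,B_0)\|_{H^m},$$ $$\|B(t)\|_{H^s}\le C(1+t)^{-\left(\frac12+\frac{m-s+1}{2(1+r)}\right)}\|(U_0,B_0)\|_{H^m}.$$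
   Context: $\mathbb{T}^n=[0,2\pi]^n$ with periodic boundary conditions; Fourier frequencies are $k\in\mathbb{Z}^n$. $U,B:\mathbb{T}^n\times[0,\infty)\to\mathbb{R}^n$ are vector fields; the system includes the divergence-free constraint, so $U_0,B_0$ are divergence free. $H^s=H^s(\mathbb{T}^n)$ is the usual $L^2$-based Sobolev space, and $\|(U_0,B_0)\|_{H^m}$ is the norm of the pair. *)

theory Defs
  imports "HOL-Analysis.Analysis"
begin

text \<open>
  Functions on the torus are represented by functions on \<open>\<real>\<^sup>n\<close> that are \<open>2\<pi>\<close>-periodic in each
  coordinate and are integrated over one period cell.
\<close>

definition torus_cell :: "(real ^ 'n::finite) set" where
  "torus_cell = cbox 0 (\<chi> i. 2 * pi)"

definition torus_periodic :: "(real ^ 'n::finite \<Rightarrow> 'a) \<Rightarrow> bool" where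
  "torus_periodic f \<longleftrightarrow> (\<forall>x i. f (x + axis i (2 * pi)) = f x)"

definition torus_L2 :: "(real ^ 'n::finite \<Rightarrow> real ^ 'n) set" where
  "torus_L2 = {f. torus_periodic f \<and> f \<in> borel_measurable (lebesgue_on torus_cell) \<and>
                  integrable (lebesgue_on torus_cell) (\<lambda>x. (norm (f x))\<^sup>2)}"

definition freq :: "int ^ 'n::finite \<Rightarrow> real ^ 'n" where
  "freq k = (\<chi> i. of_int (k $ i))"

definition fourier_coeff :: "(real ^ 'n::finite \<Rightarrow> real ^ 'n) \<Rightarrow> int ^ 'n \<Rightarrow> complex ^ 'n" where
  "fourier_coeff f k =
     (\<chi> i. (LINT x|lebesgue_on torus_cell. complex_of_real (f x $ i) * cis (- (freq k \<bullet> x)))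
            / (2 * pi) ^ CARD('n))"

definition sobolev_term :: "real \<Rightarrow> (real ^ 'n::finite \<Rightarrow> real ^ 'n) \<Rightarrow> int ^ 'n \<Rightarrow> real" where
  "sobolev_term s f k = (1 + (norm (freq k))\<^sup>2) powr s * (norm (fourier_coeff f k))\<^sup>2"

text \<open>The space \<open>H\<^sup>s\<close> for \<open>s \<ge> 0\<close>, so that its elements lie in \<open>L\<^sup>2\<close>.\<close>

definition sobolev :: "real \<Rightarrow> (real ^ 'n::finite \<Rightarrow> real ^ 'n) set" where
  "sobolev s = {f \<in> torus_L2. sobolev_term s f summable_on UNIV}"

text \<open>
  The value is meaningful only on \<open>sobolev s\<close>, since \<open>infsum\<close> of a non-summable family is \<open>0\<close>:
  a norm bound has to be accompanied by membership in \<open>sobolev s\<close>.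
\<close>

definition sobolev_norm :: "real \<Rightarrow> (real ^ 'n::finite \<Rightarrow> real ^ 'n) \<Rightarrow> real" where
  "sobolev_norm s f = sqrt (\<Sum>\<^sub>\<infinity>k. sobolev_term s f k)"

definition sobolev_norm_pair ::
  "real \<Rightarrow> (real ^ 'n::finite \<Rightarrow> real ^ 'n) \<Rightarrow> (real ^ 'n \<Rightarrow> real ^ 'n) \<Rightarrow> real" where
  "sobolev_norm_pair s f g = sqrt ((sobolev_norm s f)\<^sup>2 + (sobolev_norm s g)\<^sup>2)"

definition diophantine :: "real \<Rightarrow> real ^ 'n::finite \<Rightarrow> bool" where
  "diophantine r b \<longleftrightarrow>
     (\<exists>c>0. \<forall>k::int ^ 'n. k \<noteq> 0 \<longrightarrow> \<bar>b \<bullet> freq k\<bar> \<ge> c * norm (freq k) powr (- r))"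

definition partial_deriv :: "'n::finite \<Rightarrow> (real ^ 'n \<Rightarrow> real) \<Rightarrow> real ^ 'n \<Rightarrow> real" where
  "partial_deriv i f x = frechet_derivative f (at x) (axis i 1)"

definition gradient :: "(real ^ 'n::finite \<Rightarrow> real) \<Rightarrow> real ^ 'n \<Rightarrow> real ^ 'n" where
  "gradient f x = (\<chi> i. partial_deriv i f x)"

definition laplacian :: "(real ^ 'n::finite \<Rightarrow> real) \<Rightarrow> real ^ 'n \<Rightarrow> real" where
  "laplacian f x = (\<Sum>i\<in>UNIV. partial_deriv i (partial_deriv i f) x)"

primrec C_k :: "nat \<Rightarrow> (real ^ 'n::finite \<Rightarrow> real) \<Rightarrow> bool" where
  "C_k 0 f \<longleftrightarrow> continuous_on UNIV f"
| "C_k (Suc j) f \<longleftrightarrow> (\<forall>x. f differentiable (at x)) \<and> (\<forall>i. C_k j (partial_deriv i f))"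

definition torus_test :: "(real ^ 'n::finite \<Rightarrow> real) set" where
  "torus_test = {\<phi>. torus_periodic \<phi> \<and> (\<forall>j. C_k j \<phi>)}"

definition pairing :: "(real ^ 'n::finite \<Rightarrow> real ^ 'n) \<Rightarrow> (real ^ 'n \<Rightarrow> real) \<Rightarrow> real ^ 'n" where
  "pairing f \<phi> = (LINT x|lebesgue_on torus_cell. \<phi> x *\<^sub>R f x)"

definition weakly_div_free :: "(real ^ 'n::finite \<Rightarrow> real ^ 'n) \<Rightarrow> bool" where
  "weakly_div_free f \<longleftrightarrow>
     (\<forall>\<phi>\<in>torus_test. (LINT x|lebesgue_on torus_cell. f x \<bullet> gradient \<phi> x) = 0)"

text \<open>
  For initial data that are merely in \<open>L\<^sup>2\<close> the system is understood in the sense of distributions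
  on the torus: for each \<open>t \<ge> 0\<close> the space derivatives are moved onto a smooth periodic test
  function, while the time derivative of the pairing is a classical one (one-sided at \<open>t = 0\<close>).
  Testing with the real and imaginary parts of \<open>exp (i k \<bullet> x)\<close> shows that such a solution is
  unique up to null sets, so no continuity in time with values in \<open>L\<^sup>2\<close> has to be demanded.
  The divergence constraint at \<open>t = 0\<close> makes the initial data divergence free.
\<close>

definition linear_mhd_solution ::
  "real ^ 'n::finite \<Rightarrow> (real ^ 'n \<Rightarrow> real ^ 'n) \<Rightarrow> (real ^ 'n \<Rightarrow> real ^ 'n) \<Rightarrow>
   (real \<Rightarrow> real ^ 'n \<Rightarrow> real ^ 'n) \<Rightarrow> (real \<Rightarrow> real ^ 'n \<Rightarrow> real ^ 'n) \<Rightarrow> bool" where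
  "linear_mhd_solution b U\<^sub>0 B\<^sub>0 U B \<longleftrightarrow>
     (\<forall>t\<ge>0. U t \<in> torus_L2 \<and> B t \<in> torus_L2) \<and>
     (\<forall>\<phi>\<in>torus_test. \<forall>t\<ge>0.
        ((\<lambda>\<tau>. pairing (U \<tau>) \<phi>) has_vector_derivative
           - pairing (B t) (\<lambda>x. b \<bullet> gradient \<phi> x)) (at t within {0..})) \<and>
     (\<forall>\<phi>\<in>torus_test. \<forall>t\<ge>0.
        ((\<lambda>\<tau>. pairing (B \<tau>) \<phi>) has_vector_derivative
           pairing (B t) (laplacian \<phi>) - pairing (U t) (\<lambda>x. b \<bullet> gradient \<phi> x))
          (at t within {0..})) \<and>
     (\<forall>t\<ge>0. weakly_div_free (U t) \<and> weakly_div_free (B t)) \<and>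
     (AE x in lebesgue_on torus_cell. U 0 x = U\<^sub>0 x \<and> B 0 x = B\<^sub>0 x)"

end

theory Submission
  imports Defs
begin

text \<open>
  Pairing the system with \<open>cos (k \<bullet> x)\<close> and \<open>sin (k \<bullet> x)\<close> decouples it into real damped pairs
  \<open>u' = - a w\<close>, \<open>w' = a u - l w\<close> with \<open>a = \<plusminus> b \<bullet> k\<close> and \<open>l = \<bar>k\<bar>\<^sup>2\<close>, where \<open>u\<close> is a
  coefficient of \<open>U\<close> and \<open>w\<close> one of \<open>B\<close>. Since \<open>a\<^sup>2 \<le> \<bar>b\<bar>\<^sup>2 l\<close>, the functional
  \<open>\<bar>u\<bar>\<^sup>2 + \<bar>w\<bar>\<^sup>2 - 2 \<eta> (a / l) u \<bullet> w\<close> with small \<open>\<eta>\<close> is comparable to the energy and decays at a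
  rate proportional to \<open>a\<^sup>2 / l\<close>, which by the Diophantine condition is at least of order
  \<open>\<bar>k\<bar> powr (- 2 (1 + r))\<close>; the \<open>m - s\<close> spare derivatives turn this degenerate exponential rate into
  an algebraic one. The component \<open>w\<close> is slaved to \<open>u\<close>: up to an \<open>exp (- l t)\<close> layer it has size
  \<open>\<bar>a\<bar> / l * \<bar>u\<bar>\<close>, which yields the additional decay of \<open>B\<close>.
\<close>

section \<open>Damped pairs\<close>

text \<open>Values in an inner product space let all components of a Fourier mode be treated at
  once. The derivative within \<open>{0..}\<close> is one-sided at 0, as in the notion of
  solution.\<close>

definition damped_pair :: "real \<Rightarrow> real \<Rightarrow> (real \<Rightarrow> 'a::real_inner) \<Rightarrow> (real \<Rightarrow> 'a) \<Rightarrow> bool" where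
  "damped_pair a l u w \<longleftrightarrow>
     (\<forall>t\<ge>0. (u has_vector_derivative (- a) *\<^sub>R w t) (at t within {0..})) \<and>
     (\<forall>t\<ge>0. (w has_vector_derivative a *\<^sub>R u t - l *\<^sub>R w t) (at t within {0..}))"

lemma nonincreasing_from_zero:
  fixes G :: "real \<Rightarrow> real"
  assumes "\<And>t. t \<ge> 0 \<Longrightarrow> (G has_real_derivative G' t) (at t within {0..})"
    and "\<And>t. t \<ge> 0 \<Longrightarrow> G' t \<le> 0"
    and "t \<ge> 0"
  shows "G t \<le> G 0"
proof -
  have "(G has_derivative (\<lambda>h. G' x * h)) (at x within {0..t})" if "0 \<le> x" "x \<le> t" for x
    using assms(1)[of x] that
    by (auto simp: has_field_derivative_def intro: has_derivative_subset)
  from mvt_very_simple[OF \<open>t \<ge> 0\<close> this]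
  obtain x where "x \<in> {0..t}" "G t - G 0 = G' x * (t - 0)" by blast
  with assms(2)[of x] \<open>t \<ge> 0\<close> show ?thesis
    using mult_nonpos_nonneg[of "G' x" t] by simp
qed

text \<open>Gronwall's inequality with a forcing that decays more slowly than the homogeneous part.
  Multiplying by the integrating factor \<open>exp (\<rho> * t)\<close> and subtracting an
  antiderivative of the transformed forcing gives a nonincreasing function.\<close>

lemma exponential_comparison:
  fixes f :: "real \<Rightarrow> real"
  assumes f: "\<And>t. t \<ge> 0 \<Longrightarrow> (f has_real_derivative f' t) (at t within {0..})"
    and le: "\<And>t. t \<ge> 0 \<Longrightarrow> f' t \<le> - \<rho> * f t + A * exp (- \<sigma> * t)"
    and "\<sigma> < \<rho>" "A \<ge> 0" "t \<ge> 0"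
  shows "f t \<le> exp (- \<rho> * t) * f 0 + A / (\<rho> - \<sigma>) * exp (- \<sigma> * t)"
proof -
  define D where "D = A / (\<rho> - \<sigma>)"
  have A: "A = D * (\<rho> - \<sigma>)"
    using \<open>\<sigma> < \<rho>\<close> by (simp add: D_def)
  have "D \<ge> 0"
    using \<open>\<sigma> < \<rho>\<close> \<open>A \<ge> 0\<close> by (simp add: D_def)
  define G where "G = (\<lambda>t. exp (\<rho> * t) * f t - D * exp ((\<rho> - \<sigma>) * t))"
  define G' where "G' = (\<lambda>t. exp (\<rho> * t) * (f' t + \<rho> * f t) - A * exp ((\<rho> - \<sigma>) * t))"
  have "(G has_real_derivative G' t) (at t within {0..})" if "t \<ge> 0" for t
    unfolding G_def G'_def A
    by (auto intro!: derivative_eq_intros f that simp: algebra_simps)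
  moreover have "G' t \<le> 0" if "t \<ge> 0" for t
  proof -
    have "exp (\<rho> * t) * (f' t + \<rho> * f t) \<le> exp (\<rho> * t) * (A * exp (- \<sigma> * t))"
      using le[OF that] by (intro mult_left_mono) auto
    also have "\<dots> = A * exp ((\<rho> - \<sigma>) * t)"
      by (simp add: algebra_simps flip: exp_add)
    finally show ?thesis by (simp add: G'_def)
  qed
  ultimately have "G t \<le> G 0"
    using \<open>t \<ge> 0\<close> by (rule nonincreasing_from_zero)
  also have "G 0 \<le> f 0"
    using \<open>D \<ge> 0\<close> by (simp add: G_def)
  finally have "exp (- \<rho> * t) * (exp (\<rho> * t) * f t)
      \<le> exp (- \<rho> * t) * (f 0 + D * exp ((\<rho> - \<sigma>) * t))"
    by (intro mult_left_mono) (auto simp: G_def)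
  moreover have "exp (- \<rho> * t) * (exp (\<rho> * t) * f t) = f t"
    by (simp add: exp_minus)
  moreover have "exp (- \<rho> * t) * (f 0 + D * exp ((\<rho> - \<sigma>) * t)) = exp (- \<rho> * t) * f 0 + D * exp (- \<sigma> * t)"
  proof -
    have "exp (- \<rho> * t) * exp ((\<rho> - \<sigma>) * t) = exp (- \<sigma> * t)"
      by (simp add: algebra_simps flip: exp_add)
    then show ?thesis
      by (simp add: distrib_left mult.left_commute)
  qed
  ultimately show ?thesis
    unfolding D_def by linarith
qed

lemma two_inner_le:
  fixes x y :: "'a::real_inner"
  shows "2 * \<bar>x \<bullet> y\<bar> \<le> (norm x)\<^sup>2 + (norm y)\<^sup>2"
  using Cauchy_Schwarz_ineq2[of x y] sum_squares_bound[of "norm x" "norm y"] by simp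

text \<open>Young's inequality, with the weights chosen so that \<open>y\<close> is charged to the
  damping \<open>l\<close> and \<open>x\<close> to the slow rate
  \<open>a\<^sup>2 / l\<close>.\<close>

lemma weighted_inner_le:
  fixes x y :: "'a::real_inner"
  assumes "l > 0"
  shows "2 * a * (x \<bullet> y) \<le> a\<^sup>2 / l * (norm x)\<^sup>2 + l * (norm y)\<^sup>2"
proof -
  have "2 * ((a / sqrt l) *\<^sub>R x \<bullet> sqrt l *\<^sub>R y)
      \<le> (norm ((a / sqrt l) *\<^sub>R x))\<^sup>2 + (norm (sqrt l *\<^sub>R y))\<^sup>2"
    using two_inner_le[of "(a / sqrt l) *\<^sub>R x" "sqrt l *\<^sub>R y"] by linarith
  then show ?thesis
    using assms by (simp add: power_mult_distrib power_divide)
qed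

text \<open>The energy alone dissipates only \<open>w\<close>, at rate \<open>2 * l\<close>. The
  derivative of the cross term supplies \<open>- 2 * \<eta> * z * (norm (u t))\<^sup>2\<close>, so
  \<open>u\<close> is damped as well. Since \<open>L\<close> lies between 1/2 and 3/2 of the energy,
  the rate \<open>\<eta> * z\<close> for the energy becomes 2/3 of it for \<open>L\<close>, and the
  quotient of the two bounds is the factor 3.\<close>

lemma damped_pair_energy_decay:
  fixes u w :: "real \<Rightarrow> 'a::real_inner"
  assumes pair: "damped_pair a l u w"
    and "l \<ge> 1" "K \<ge> 0" and aK: "a\<^sup>2 \<le> K * l"
    and \<eta>: "\<eta> = 1 / (2 + 2 * K)"
    and "t \<ge> 0"
  shows "(norm (u t))\<^sup>2 + (norm (w t))\<^sup>2
           \<le> 3 * exp (- (2/3 * \<eta> * (a\<^sup>2 / l)) * t) * ((norm (u 0))\<^sup>2 + (norm (w 0))\<^sup>2)"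
proof -
  define z where "z = a\<^sup>2 / l"
  define \<delta> where "\<delta> = \<eta> * a / l"
  define E where "E = (\<lambda>t. (norm (u t))\<^sup>2 + (norm (w t))\<^sup>2)"
  define L where "L = (\<lambda>t. u t \<bullet> u t + w t \<bullet> w t - 2 * \<delta> * (u t \<bullet> w t))"
  define L' where "L' = (\<lambda>t. - 2 * l * (norm (w t))\<^sup>2 - 2 * \<eta> * z * (norm (u t))\<^sup>2
      + 2 * \<eta> * z * (norm (w t))\<^sup>2 + \<eta> * (2 * a * (u t \<bullet> w t)))"
  \<comment> \<open>The size of \<eta> is used twice: the bounds on \<eta> and \<eta> K by 1/2 keep
    the cross term below half of the energy, and together with the last inequality they let the
    damping of \<open>w\<close> absorb every other term in \<open>w\<close>.\<close>
  have "\<eta> > 0" "\<eta> \<le> 1/2" "\<eta> * K \<le> 1/2" "\<eta> + 2 * (\<eta> * K) \<le> 1"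
    using \<open>K \<ge> 0\<close> by (auto simp: \<eta> field_simps)
  have z: "0 \<le> z" "z \<le> K"
    using aK \<open>l \<ge> 1\<close> by (auto simp: z_def field_simps)
  then have "z \<le> K * l"
    using \<open>l \<ge> 1\<close> \<open>K \<ge> 0\<close> mult_left_mono[of 1 l K] by simp
  have \<eta>z: "0 \<le> \<eta> * z" "\<eta> * z \<le> \<eta> * K" "\<eta> * z \<le> \<eta> * K * l"
    using z \<open>z \<le> K * l\<close> \<open>\<eta> > 0\<close> by (auto simp: mult.assoc)
  have "\<delta>\<^sup>2 = \<eta> * (\<eta> * z) / l"
    by (simp add: \<delta>_def z_def power2_eq_square)
  also have "\<dots> \<le> \<eta> * (\<eta> * z)"
    using \<open>l \<ge> 1\<close> \<eta>z \<open>\<eta> > 0\<close> mult_left_mono[of 1 l "\<eta> * (\<eta> * z)"] by (simp add: divide_le_eq)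
  also have "\<dots> \<le> 1/2 * (1/2)"
    using \<eta>z(1) \<open>\<eta> \<le> 1/2\<close> order.trans[OF \<eta>z(2) \<open>\<eta> * K \<le> 1/2\<close>] by (intro mult_mono) simp_all
  finally have "\<bar>\<delta>\<bar> \<le> 1/2"
    using abs_le_square_iff[of \<delta> "1/2"] by (simp add: power2_eq_square)
  have cross: "\<bar>2 * \<delta> * (u t \<bullet> w t)\<bar> \<le> 1/2 * E t" for t
  proof -
    have "\<bar>\<delta>\<bar> * (2 * \<bar>u t \<bullet> w t\<bar>) \<le> 1/2 * ((norm (u t))\<^sup>2 + (norm (w t))\<^sup>2)"
      using \<open>\<bar>\<delta>\<bar> \<le> 1/2\<close> two_inner_le by (intro mult_mono) auto
    then show ?thesis by (simp add: abs_mult E_def)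
  qed
  have EL: "1/2 * E t \<le> L t" "L t \<le> 3/2 * E t" for t
    using cross[of t] by (auto simp: L_def E_def power2_norm_eq_inner)
  have dL: "(L has_real_derivative L' t) (at t within {0..})" if "t \<ge> 0" for t
  proof -
    have u: "(u has_derivative (\<lambda>h. h *\<^sub>R ((- a) *\<^sub>R w t))) (at t within {0..})"
      and w: "(w has_derivative (\<lambda>h. h *\<^sub>R (a *\<^sub>R u t - l *\<^sub>R w t))) (at t within {0..})"
      using pair that by (auto simp: damped_pair_def has_vector_derivative_def)
    have "\<delta> * l = \<eta> * a" "\<delta> * a = \<eta> * z"
      using \<open>l \<ge> 1\<close> by (auto simp: \<delta>_def z_def power2_eq_square)
    then have L': "L' t = - 2 * l * (w t \<bullet> w t) - 2 * (\<delta> * a) * (u t \<bullet> u t)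
        + 2 * (\<delta> * a) * (w t \<bullet> w t) + 2 * (\<delta> * l) * (u t \<bullet> w t)"
      by (simp add: L'_def power2_norm_eq_inner)
    show ?thesis
      unfolding has_field_derivative_def L_def
      by (rule derivative_eq_intros u w refl)+
        (simp add: L' fun_eq_iff inner_commute[of "w t" "u t"] inner_diff_left inner_diff_right
          algebra_simps)
  qed
  \<comment> \<open>The vanishing forcing term puts the bound in the form required by the comparison lemma.\<close>
  have L'_le: "L' t \<le> - (2/3 * \<eta> * z) * L t + 0 * exp (- (2/3 * \<eta> * z - 1) * t)" if "t \<ge> 0" for t
  proof -
    \<comment> \<open>Young's inequality spends half of the gain in \<open>u\<close> and a share
      \<eta> l of the damping of \<open>w\<close>; the other half of the gain remains as the rate
      \<eta> z.\<close>
    have "\<eta> * (2 * a * (u t \<bullet> w t)) \<le> \<eta> * (z * (norm (u t))\<^sup>2 + l * (norm (w t))\<^sup>2)"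
      unfolding z_def using \<open>\<eta> > 0\<close> \<open>l \<ge> 1\<close> by (intro mult_left_mono weighted_inner_le) auto
    then have "L' t \<le> - (\<eta> * z) * (norm (u t))\<^sup>2 - (2 * l - \<eta> * l - 2 * (\<eta> * z)) * (norm (w t))\<^sup>2"
      by (simp add: L'_def algebra_simps)
    also have "\<dots> \<le> - (\<eta> * z) * (norm (u t))\<^sup>2 - (\<eta> * z) * (norm (w t))\<^sup>2"
    proof -
      have "(\<eta> + 2 * (\<eta> * K)) * l \<le> 1 * l"
        using \<open>\<eta> + 2 * (\<eta> * K) \<le> 1\<close> \<open>l \<ge> 1\<close> by (intro mult_right_mono) auto
      moreover have "\<eta> * K * l \<le> 1/2 * l"
        using \<open>\<eta> * K \<le> 1/2\<close> \<open>l \<ge> 1\<close> by (intro mult_right_mono) auto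
      ultimately have "\<eta> * z \<le> 2 * l - \<eta> * l - 2 * (\<eta> * z)"
        using \<eta>z \<open>l \<ge> 1\<close> by (simp add: algebra_simps)
      then have "\<eta> * z * (norm (w t))\<^sup>2 \<le> (2 * l - \<eta> * l - 2 * (\<eta> * z)) * (norm (w t))\<^sup>2"
        by (intro mult_right_mono) auto
      then show ?thesis by linarith
    qed
    also have "\<dots> = - (2/3 * \<eta> * z) * (3/2 * E t)"
      by (simp add: E_def algebra_simps)
    also have "\<dots> \<le> - (2/3 * \<eta> * z) * L t"
      using EL(2)[of t] \<eta>z by (intro mult_left_mono_neg) auto
    finally show ?thesis by simp
  qed
  have "L t \<le> exp (- (2/3 * \<eta> * z) * t) * L 0"
    using exponential_comparison[OF dL L'_le _ _ \<open>t \<ge> 0\<close>] by simp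
  also have "\<dots> \<le> exp (- (2/3 * \<eta> * z) * t) * (3/2 * E 0)"
    using EL(2)[of 0] by (intro mult_left_mono) auto
  finally show ?thesis
    using EL(1)[of t] unfolding E_def z_def by (simp add: algebra_simps)
qed

text \<open>In the equation for \<open>(norm (w t))\<^sup>2\<close> half of the damping
  \<open>2 * l\<close> absorbs the coupling, leaving a forcing of size z times the square of
  \<open>u\<close>, which the energy bound controls. Integrating against
  \<open>exp (- l * t)\<close> divides this forcing by about l, so beyond the initial layer
  \<open>w\<close> gains the factor z / l.\<close>

lemma damped_pair_slaved_decay:
  fixes u w :: "real \<Rightarrow> 'a::real_inner"
  assumes pair: "damped_pair a l u w"
    and "l \<ge> 1" "K \<ge> 0" and aK: "a\<^sup>2 \<le> K * l"
    and \<eta>: "\<eta> = 1 / (2 + 2 * K)"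
    and "t \<ge> 0"
  shows "(norm (w t))\<^sup>2 \<le> exp (- l * t) * (norm (w 0))\<^sup>2
           + 6 / l * (a\<^sup>2 / l) * exp (- (2/3 * \<eta> * (a\<^sup>2 / l)) * t)
               * ((norm (u 0))\<^sup>2 + (norm (w 0))\<^sup>2)"
proof -
  define z where "z = a\<^sup>2 / l"
  define \<sigma> where "\<sigma> = 2/3 * \<eta> * z"
  define E0 where "E0 = (norm (u 0))\<^sup>2 + (norm (w 0))\<^sup>2"
  have "\<eta> > 0" "\<eta> * K \<le> 1/2"
    using \<open>K \<ge> 0\<close> by (auto simp: \<eta> field_simps)
  have z: "0 \<le> z" "z \<le> K"
    using aK \<open>l \<ge> 1\<close> by (auto simp: z_def field_simps)
  have "\<eta> * z \<le> \<eta> * K"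
    using z \<open>\<eta> > 0\<close> by simp
  then have "\<sigma> \<le> l / 2"
    using \<open>\<eta> * K \<le> 1/2\<close> \<open>l \<ge> 1\<close> by (simp add: \<sigma>_def)
  have "E0 \<ge> 0" by (simp add: E0_def)
  define f' where "f' = (\<lambda>t. 2 * a * (u t \<bullet> w t) - 2 * l * (norm (w t))\<^sup>2)"
  have d: "((\<lambda>t. (norm (w t))\<^sup>2) has_real_derivative f' t) (at t within {0..})" if "t \<ge> 0" for t
  proof -
    have w: "(w has_derivative (\<lambda>h. h *\<^sub>R (a *\<^sub>R u t - l *\<^sub>R w t))) (at t within {0..})"
      using pair that by (auto simp: damped_pair_def has_vector_derivative_def)
    show ?thesis
      unfolding has_field_derivative_def power2_norm_eq_inner f'_def
      by (rule derivative_eq_intros w refl)+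
        (auto simp: inner_commute algebra_simps inner_diff_right inner_diff_left fun_eq_iff)
  qed
  have "f' t \<le> - l * (norm (w t))\<^sup>2 + 3 * z * E0 * exp (- \<sigma> * t)" if "t \<ge> 0" for t
  proof -
    have "(norm (u t))\<^sup>2 \<le> 3 * exp (- \<sigma> * t) * E0"
      using damped_pair_energy_decay[OF pair \<open>l \<ge> 1\<close> \<open>K \<ge> 0\<close> aK \<eta> that]
        zero_le_power2[of "norm (w t)"]
      unfolding E0_def \<sigma>_def z_def by linarith
    then have "z * (norm (u t))\<^sup>2 \<le> z * (3 * exp (- \<sigma> * t) * E0)"
      using z by (intro mult_left_mono) auto
    moreover have "2 * a * (u t \<bullet> w t) \<le> z * (norm (u t))\<^sup>2 + l * (norm (w t))\<^sup>2"
      unfolding z_def using \<open>l \<ge> 1\<close> by (intro weighted_inner_le) auto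
    ultimately show ?thesis
      by (simp add: f'_def algebra_simps)
  qed
  from exponential_comparison[OF d this _ _ \<open>t \<ge> 0\<close>]
  have "(norm (w t))\<^sup>2 \<le> exp (- l * t) * (norm (w 0))\<^sup>2 + 3 * z * E0 / (l - \<sigma>) * exp (- \<sigma> * t)"
    using \<open>\<sigma> \<le> l / 2\<close> \<open>l \<ge> 1\<close> z \<open>E0 \<ge> 0\<close> by simp
  \<comment> \<open>The slow rate is at most half of the fast one, so the gap
    \<open>l - \<sigma>\<close> is at least \<open>l / 2\<close>; this turns 3 into 6.\<close>
  also have "3 * z * E0 / (l - \<sigma>) \<le> 3 * z * E0 / (l / 2)"
    using \<open>\<sigma> \<le> l / 2\<close> \<open>l \<ge> 1\<close> z \<open>E0 \<ge> 0\<close> by (intro divide_left_mono) auto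
  finally show ?thesis
    by (simp add: E0_def z_def \<sigma>_def algebra_simps add_divide_distrib)
qed

section \<open>Algebraic decay of the multipliers\<close>

lemma powr_times_exp_bounded:
  fixes \<kappa> q :: real
  assumes "\<kappa> > 0" "q \<ge> 0"
  shows "\<exists>M>0. \<forall>y>0. y powr q * exp (- \<kappa> * y) \<le> M"
proof (cases "q = 0")
  case True
  then show ?thesis
    using assms by (intro exI[of _ 1]) auto
next
  case False
  with assms have "q > 0" by simp
  have "y powr q * exp (- \<kappa> * y) \<le> (q / \<kappa>) powr q" if "y > 0" for y
  proof -
    \<comment> \<open>The function to be bounded is largest at y = q / \<kappa>, so the tangent
      bound of the logarithm is taken relative to that point.\<close>
    have "ln (\<kappa> * y / q) \<le> \<kappa> * y / q"
      using that assms \<open>q > 0\<close> by (intro order.trans[OF ln_le_minus_one]) auto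
    then have "q * ln y \<le> q * ln (q / \<kappa>) + \<kappa> * y"
      using that assms \<open>q > 0\<close> by (simp add: ln_mult ln_div field_simps)
    then have "exp (q * ln y + (- \<kappa> * y)) \<le> exp (q * ln (q / \<kappa>))"
      by simp
    then show ?thesis
      using that assms \<open>q > 0\<close> unfolding exp_add by (simp add: powr_def)
  qed
  then show ?thesis
    using assms \<open>q > 0\<close> by (intro exI[of _ "(q / \<kappa>) powr q"]) auto
qed

text \<open>Trades smoothness for decay: the rate \<open>X powr (- p)\<close> degenerates for large
  X, but powers of the product of rate and time are bounded against the exponential, and
  \<open>X powr d\<close> compensates for the smallness of the rate.\<close>

lemma degenerate_exponential_decay:
  fixes \<kappa> p d :: real
  assumes "\<kappa> > 0" "p > 0" "d \<ge> 0"
  shows "\<exists>M>0. \<forall>X\<ge>1. \<forall>t\<ge>0.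
           exp (- \<kappa> * (X powr (- p) * t)) \<le> M * (1 + t) powr (- (d / p)) * X powr d"
proof -
  obtain M where "M > 0" and M: "\<And>y. y > 0 \<Longrightarrow> y powr (d / p) * exp (- \<kappa> * y) \<le> M"
    using powr_times_exp_bounded[of \<kappa> "d / p"] assms by auto
  have "exp (- \<kappa> * (X powr (- p) * t)) \<le> exp \<kappa> * M * (1 + t) powr (- (d / p)) * X powr d"
    if "X \<ge> 1" "t \<ge> 0" for X t
  proof -
    \<comment> \<open>Replacing t by 1 + t keeps y positive at t = 0 and costs only the factor
      \<open>exp \<kappa>\<close>, because the rate \<open>X powr (- p)\<close> is at most
      1.\<close>
    define y where "y = (1 + t) * X powr (- p)"
    have "y > 0" using that by (simp add: y_def)
    have "X powr (- p) \<le> 1"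
      using that assms powr_mono[of "- p" 0 X] by simp
    then have "\<kappa> * X powr (- p) \<le> \<kappa> * 1"
      using assms by (intro mult_left_mono) auto
    then have "exp (- \<kappa> * (X powr (- p) * t)) \<le> exp (\<kappa> + (- \<kappa> * y))"
      by (simp add: y_def algebra_simps)
    also have "\<dots> = exp \<kappa> * exp (- \<kappa> * y)" by (rule exp_add)
    also have "exp (- \<kappa> * y) \<le> M * y powr (- (d / p))"
      using M[OF \<open>y > 0\<close>] \<open>y > 0\<close> by (simp add: powr_minus field_simps)
    also have "y powr (- (d / p)) = (1 + t) powr (- (d / p)) * X powr d"
      using that assms by (simp add: y_def powr_mult powr_powr)
    finally show ?thesis by (simp add: mult.assoc)
  qed
  then show ?thesis
    using \<open>M > 0\<close> by (intro exI[of _ "exp \<kappa> * M"]) auto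
qed

text \<open>The prefactor z is itself the decay rate, so it yields a full power of 1 + t uniformly
  in z: x exp (- x) \<le> 1 handles large t, the bound K small t, and the two are added.\<close>

lemma linear_times_exp_decay:
  fixes z \<nu> K t :: real
  assumes "0 \<le> z" "z \<le> K" "\<nu> > 0" "t \<ge> 0"
  shows "z * exp (- \<nu> * z * t) \<le> (K + 1 / \<nu>) * (1 + t) powr (-1)"
proof -
  have "\<nu> * z * t \<le> exp (\<nu> * z * t)"
    using exp_ge_add_one_self[of "\<nu> * z * t"] by linarith
  then have "\<nu> * z * t * exp (- (\<nu> * z * t)) \<le> exp (\<nu> * z * t) * exp (- (\<nu> * z * t))"
    by (rule mult_right_mono) simp
  then have "t * (z * exp (- \<nu> * z * t)) \<le> 1 / \<nu>"
    using \<open>\<nu> > 0\<close> by (simp add: field_simps flip: exp_add)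
  moreover have "z * exp (- \<nu> * z * t) \<le> K * 1"
    using assms by (intro mult_mono) auto
  ultimately have "(1 + t) * (z * exp (- \<nu> * z * t)) \<le> K + 1 / \<nu>"
    by (simp add: algebra_simps)
  then show ?thesis
    using \<open>t \<ge> 0\<close> by (simp add: powr_minus_divide field_simps)
qed

text \<open>The per-mode form of the theorem, with squared norms and 1 + l as the Sobolev weight.
  The constant is chosen before a and l, hence is uniform over all frequencies.\<close>

lemma damped_pair_sobolev_decay:
  fixes K c p m s :: real
  assumes "K \<ge> 0" "c > 0" "p > 0" "s \<le> m"
  shows "\<exists>C>0. \<forall>a l (u :: real \<Rightarrow> 'a::real_inner) w (t::real).
      damped_pair a l u w \<longrightarrow> l \<ge> 1 \<longrightarrow> a\<^sup>2 \<le> K * l \<longrightarrow> a\<^sup>2 / l \<ge> c * (1 + l) powr (- p) \<longrightarrow> t \<ge> 0 \<longrightarrow>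
        (1 + l) powr s * (norm (u t))\<^sup>2
          \<le> C * (1 + t) powr (- ((m - s) / p))
              * ((1 + l) powr m * ((norm (u 0))\<^sup>2 + (norm (w 0))\<^sup>2)) \<and>
        (1 + l) powr s * (norm (w t))\<^sup>2
          \<le> C * (1 + t) powr (- (1 + (m - s + 1) / p))
              * ((1 + l) powr m * ((norm (u 0))\<^sup>2 + (norm (w 0))\<^sup>2))"
proof -
  define \<eta> where "\<eta> = 1 / (2 + 2 * K)"
  have "\<eta> > 0" using assms by (simp add: \<eta>_def)
  \<comment> \<open>Half of the available rate 2/3 \<eta>: in the bound for \<open>w\<close> one
    half is spent on the prefactor z and the other on the weight.\<close>
  define \<nu> where "\<nu> = \<eta> / 3"
  have "\<nu> > 0" using \<open>\<eta> > 0\<close> by (simp add: \<nu>_def)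
  obtain M1 where M1: "M1 > 0" "\<And>X t. X \<ge> 1 \<Longrightarrow> t \<ge> 0 \<Longrightarrow>
      exp (- (2 * \<nu> * c) * (X powr (- p) * t)) \<le> M1 * (1 + t) powr (- ((m - s) / p)) * X powr (m - s)"
    using degenerate_exponential_decay[of "2 * \<nu> * c" p "m - s"] assms \<open>\<nu> > 0\<close> by auto
  \<comment> \<open>One more power of X than for \<open>u\<close> may be used, since the factor 1 /
    l of the slaved bound pays for it.\<close>
  obtain M2 where M2: "M2 > 0" "\<And>X t. X \<ge> 1 \<Longrightarrow> t \<ge> 0 \<Longrightarrow>
      exp (- (\<nu> * c) * (X powr (- p) * t)) \<le> M2 * (1 + t) powr (- ((m - s + 1) / p)) * X powr (m - s + 1)"
    using degenerate_exponential_decay[of "\<nu> * c" p "m - s + 1"] assms \<open>\<nu> > 0\<close> by auto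
  define Q where "Q = 1 + (m - s + 1) / p"
  have "Q \<ge> 0" using assms by (simp add: Q_def)
  \<comment> \<open>Algebraic bound for the initial layer, whose rate is at least 1; it is the case
    X = 1 and p = 1 of the degenerate estimate.\<close>
  obtain M3 where M3: "M3 > 0" "\<And>t. t \<ge> 0 \<Longrightarrow> exp (- t) \<le> M3 * (1 + t) powr (- Q)"
  proof -
    from degenerate_exponential_decay[of 1 1 Q] \<open>Q \<ge> 0\<close>
    obtain M where "M > 0" and M: "\<forall>X\<ge>1. \<forall>t\<ge>0.
        exp (- 1 * (X powr (- 1) * t)) \<le> M * (1 + t) powr (- (Q / 1)) * X powr Q"
      by auto
    show ?thesis
      using M[rule_format, of 1] \<open>M > 0\<close> by (intro that[of M]) auto
  qed
  define C2 where "C2 = M3 + 12 * (K + 1 / \<nu>) * M2"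
  have "C2 > 0"
    using M2 M3 assms \<open>\<nu> > 0\<close> by (auto simp: C2_def intro!: add_pos_nonneg)
  define C where "C = max (3 * M1) C2"
  show ?thesis
  proof (intro exI[of _ C] conjI allI impI)
    show "C > 0" using M1 by (simp add: C_def)
  next
    fix a l t :: real and u w :: "real \<Rightarrow> 'a"
    assume pair: "damped_pair a l u w" and "l \<ge> 1" and aK: "a\<^sup>2 \<le> K * l"
      and dio: "a\<^sup>2 / l \<ge> c * (1 + l) powr (- p)" and "t \<ge> 0"
    define z where "z = a\<^sup>2 / l"
    define E0 where "E0 = (norm (u 0))\<^sup>2 + (norm (w 0))\<^sup>2"
    define X where "X = 1 + l"
    have [simp]: "E0 \<ge> 0" "X \<ge> 1" "X > 0" "X \<ge> 0" "X powr y \<ge> 0" "(1 + t) powr y \<ge> 0" for y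
      using \<open>l \<ge> 1\<close> by (auto simp: E0_def X_def)
    have z: "0 \<le> z" "z \<le> K" "c * X powr (- p) \<le> z"
      using aK dio \<open>l \<ge> 1\<close> by (simp_all add: z_def X_def divide_le_eq)
    have rate: "exp (- \<mu> * z * t) \<le> exp (- (\<mu> * c) * (X powr (- p) * t))" if "\<mu> > 0" for \<mu>
      using mult_right_mono[OF mult_left_mono[OF z(3), of \<mu>] \<open>t \<ge> 0\<close>] that
      by (simp add: algebra_simps)
    have "(norm (u t))\<^sup>2 \<le> (norm (u t))\<^sup>2 + (norm (w t))\<^sup>2"
      by simp
    also have "\<dots> \<le> 3 * exp (- (2 * \<nu>) * z * t) * E0"
      using damped_pair_energy_decay[OF pair \<open>l \<ge> 1\<close> \<open>K \<ge> 0\<close> aK \<eta>_def \<open>t \<ge> 0\<close>]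
      unfolding z_def E0_def \<nu>_def by (simp add: mult.assoc)
    also have "exp (- (2 * \<nu>) * z * t) \<le> M1 * (1 + t) powr (- ((m - s) / p)) * X powr (m - s)"
      using order.trans[OF rate[of "2 * \<nu>"] M1(2)] \<open>\<nu> > 0\<close> \<open>t \<ge> 0\<close> by simp
    finally have "X powr s * (norm (u t))\<^sup>2
        \<le> X powr s * (3 * (M1 * (1 + t) powr (- ((m - s) / p)) * X powr (m - s)) * E0)"
      by (simp add: mult_left_mono mult_right_mono)
    also have "\<dots> = 3 * M1 * ((1 + t) powr (- ((m - s) / p)) * ((X powr s * X powr (m - s)) * E0))"
      by (simp only: ac_simps)
    also have "X powr s * X powr (m - s) = X powr m"
      by (simp flip: powr_add)
    also have "3 * M1 * ((1 + t) powr (- ((m - s) / p)) * (X powr m * E0))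
        \<le> C * ((1 + t) powr (- ((m - s) / p)) * (X powr m * E0))"
      by (intro mult_right_mono) (auto simp: C_def)
    finally show "(1 + l) powr s * (norm (u t))\<^sup>2 \<le> C * (1 + t) powr (- ((m - s) / p))
        * ((1 + l) powr m * ((norm (u 0))\<^sup>2 + (norm (w 0))\<^sup>2))"
      by (simp add: E0_def X_def mult.assoc)

    have "exp (- l * t) \<le> exp (- t)"
      using \<open>l \<ge> 1\<close> \<open>t \<ge> 0\<close> mult_right_mono[of 1 l t] by simp
    also have "\<dots> \<le> M3 * (1 + t) powr (- Q)"
      using M3(2) \<open>t \<ge> 0\<close> .
    finally have fast: "exp (- l * t) * (norm (w 0))\<^sup>2 \<le> M3 * (1 + t) powr (- Q) * E0"
      using M3(1) by (intro mult_mono) (auto simp: E0_def)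
    \<comment> \<open>The first half of the exponential turns z into (1 + t) to the power -1; the
      second turns m - s + 1 powers of X into the remaining decay.\<close>
    have "z * exp (- (2 * \<nu>) * z * t) = (z * exp (- \<nu> * z * t)) * exp (- \<nu> * z * t)"
      by (simp add: algebra_simps flip: exp_add)
    also have "\<dots> \<le> ((K + 1 / \<nu>) * (1 + t) powr (-1))
        * (M2 * (1 + t) powr (- ((m - s + 1) / p)) * X powr (m - s + 1))"
      using order.trans[OF rate[of \<nu>] M2(2)] \<open>\<nu> > 0\<close> \<open>t \<ge> 0\<close> z \<open>K \<ge> 0\<close>
      by (intro mult_mono linear_times_exp_decay) auto
    also have "\<dots> = (K + 1 / \<nu>) * M2 * (((1 + t) powr (-1) * (1 + t) powr (- ((m - s + 1) / p)))
        * X powr (m - s + 1))"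
      by (simp only: ac_simps)
    also have "(1 + t) powr (-1) * (1 + t) powr (- ((m - s + 1) / p)) = (1 + t) powr (- Q)"
      by (simp only: Q_def minus_add_distrib powr_add)
    finally have slow: "z * exp (- (2 * \<nu>) * z * t)
        \<le> (K + 1 / \<nu>) * M2 * ((1 + t) powr (- Q) * X powr (m - s + 1))" .
    \<comment> \<open>Since l \<ge> 1, X is at most 2 l; dividing by X cancels the extra power in m
      - s + 1.\<close>
    have "6 / l \<le> 12 / X"
      using \<open>l \<ge> 1\<close> by (simp add: X_def field_simps)
    then have "6 / l * (z * exp (- (2 * \<nu>) * z * t))
        \<le> 12 / X * ((K + 1 / \<nu>) * M2 * ((1 + t) powr (- Q) * X powr (m - s + 1)))"
      using slow z by (intro mult_mono[of "6 / l"]) auto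
    also have "\<dots> = 12 * (K + 1 / \<nu>) * M2 * ((1 + t) powr (- Q) * (X powr (m - s + 1) / X))"
      by simp
    also have "X powr (m - s + 1) / X = X powr (m - s)"
      by (simp add: powr_add)
    finally have "6 / l * (z * exp (- (2 * \<nu>) * z * t)) * E0
        \<le> 12 * (K + 1 / \<nu>) * M2 * ((1 + t) powr (- Q) * X powr (m - s)) * E0"
      by (rule mult_right_mono) simp
    moreover have "(norm (w t))\<^sup>2
        \<le> exp (- l * t) * (norm (w 0))\<^sup>2 + 6 / l * (z * exp (- (2 * \<nu>) * z * t)) * E0"
      using damped_pair_slaved_decay[OF pair \<open>l \<ge> 1\<close> \<open>K \<ge> 0\<close> aK \<eta>_def \<open>t \<ge> 0\<close>]
      unfolding z_def E0_def \<nu>_def by (simp add: mult.assoc)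
    \<comment> \<open>The layer carries no power of X; as X \<ge> 1 and s \<le> m, it may be
      enlarged to match the weight of the slow part.\<close>
    moreover have "M3 * (1 + t) powr (- Q) * E0 \<le> M3 * ((1 + t) powr (- Q) * X powr (m - s)) * E0"
      using M3(1) \<open>s \<le> m\<close>
      by (intro mult_right_mono mult_left_mono) (auto simp: ge_one_powr_ge_zero mult_le_cancel_left1)
    ultimately have "(norm (w t))\<^sup>2 \<le> C2 * ((1 + t) powr (- Q) * X powr (m - s)) * E0"
      using fast unfolding C2_def distrib_right by linarith
    then have "X powr s * (norm (w t))\<^sup>2
        \<le> X powr s * (C2 * ((1 + t) powr (- Q) * X powr (m - s)) * E0)"
      by (intro mult_left_mono) auto
    also have "\<dots> = C2 * ((1 + t) powr (- Q) * ((X powr s * X powr (m - s)) * E0))"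
      by (simp only: ac_simps)
    also have "X powr s * X powr (m - s) = X powr m"
      by (simp flip: powr_add)
    also have "C2 * ((1 + t) powr (- Q) * (X powr m * E0)) \<le> C * ((1 + t) powr (- Q) * (X powr m * E0))"
      by (intro mult_right_mono) (auto simp: C_def)
    finally show "(1 + l) powr s * (norm (w t))\<^sup>2 \<le> C * (1 + t) powr (- (1 + (m - s + 1) / p))
        * ((1 + l) powr m * ((norm (u 0))\<^sup>2 + (norm (w 0))\<^sup>2))"
      by (simp add: E0_def X_def Q_def mult.assoc)
  qed
qed

section \<open>Fourier modes of the solution\<close>

text \<open>Test functions are real, so both phases of a frequency share one family. It is closed
  under differentiation, which sends (A, B) to (B, -A) up to a factor.\<close>

definition trig_wave :: "real ^ 'n::finite \<Rightarrow> real \<Rightarrow> real \<Rightarrow> real ^ 'n \<Rightarrow> real" where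
  "trig_wave \<kappa> A B x = A * cos (\<kappa> \<bullet> x) + B * sin (\<kappa> \<bullet> x)"

lemma trig_wave_has_derivative:
  "(trig_wave \<kappa> A B has_derivative (\<lambda>h. (\<kappa> \<bullet> h) * trig_wave \<kappa> B (- A) x)) (at x)"
  unfolding trig_wave_def
  by (auto intro!: derivative_eq_intros simp: algebra_simps)

lemma partial_deriv_trig_wave:
  "partial_deriv i (trig_wave \<kappa> A B) = trig_wave \<kappa> (\<kappa> $ i * B) (- (\<kappa> $ i * A))"
proof
  fix x
  have "frechet_derivative (trig_wave \<kappa> A B) (at x) = (\<lambda>h. (\<kappa> \<bullet> h) * trig_wave \<kappa> B (- A) x)"
    by (rule frechet_derivative_at[symmetric]) (rule trig_wave_has_derivative)
  then show "partial_deriv i (trig_wave \<kappa> A B) x = trig_wave \<kappa> (\<kappa> $ i * B) (- (\<kappa> $ i * A)) x"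
    by (simp add: partial_deriv_def inner_axis trig_wave_def algebra_simps)
qed

lemma C_k_trig_wave: "C_k j (trig_wave \<kappa> A B)"
proof (induction j arbitrary: A B)
  case 0
  show ?case
    unfolding C_k.simps trig_wave_def by (intro continuous_intros)
next
  case (Suc j)
  then show ?case
    by (simp add: partial_deriv_trig_wave differentiableI[OF trig_wave_has_derivative])
qed

lemma trig_wave_test:
  fixes k :: "int ^ 'n::finite"
  shows "trig_wave (freq k) A B \<in> torus_test"
proof -
  have "freq k \<bullet> (x + axis i (2 * pi)) = freq k \<bullet> x + 2 * pi * of_int (k $ i)" for x :: "real ^ 'n" and i
    by (simp add: inner_add_right inner_axis freq_def)
  then show ?thesis
    by (simp add: torus_test_def torus_periodic_def C_k_trig_wave trig_wave_def cos_add sin_add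
        cos_int_2pin sin_int_2pin)
qed

lemma gradient_trig_wave: "gradient (trig_wave \<kappa> A B) x = trig_wave \<kappa> B (- A) x *\<^sub>R \<kappa>"
  by (simp add: gradient_def partial_deriv_trig_wave vec_eq_iff trig_wave_def algebra_simps)

lemma laplacian_trig_wave:
  "laplacian (trig_wave \<kappa> A B) x = - (norm \<kappa>)\<^sup>2 * trig_wave \<kappa> A B x"
proof -
  have "partial_deriv i (partial_deriv i (trig_wave \<kappa> A B)) x
      = - (\<kappa> $ i * \<kappa> $ i * trig_wave \<kappa> A B x)" for i
    by (simp add: partial_deriv_trig_wave trig_wave_def algebra_simps)
  moreover have "(norm \<kappa>)\<^sup>2 = (\<Sum>i\<in>UNIV. \<kappa> $ i * \<kappa> $ i)"
    by (simp add: power2_norm_eq_inner inner_vec_def)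
  ultimately show ?thesis
    by (simp add: laplacian_def sum_negf sum_distrib_right)
qed

lemma pairing_cmult: "pairing f (\<lambda>x. c * \<phi> x) = c *\<^sub>R pairing f \<phi>"
  by (simp add: pairing_def flip: scaleR_scaleR)

lemma pairing_trig_wave_minus: "pairing f (trig_wave \<kappa> (- A) (- B)) = - pairing f (trig_wave \<kappa> A B)"
proof -
  have "trig_wave \<kappa> (- A) (- B) = (\<lambda>x. -1 * trig_wave \<kappa> A B x)"
    by (simp add: trig_wave_def fun_eq_iff)
  then show ?thesis
    by (simp only: pairing_cmult scaleR_minus1_left)
qed

lemma solution_mode_derivative:
  assumes sol: "linear_mhd_solution b U\<^sub>0 B\<^sub>0 U B" and "t \<ge> 0"
  shows "((\<lambda>\<tau>. pairing (U \<tau>) (trig_wave (freq k) P Q)) has_vector_derivative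
            - ((b \<bullet> freq k) *\<^sub>R pairing (B t) (trig_wave (freq k) Q (- P)))) (at t within {0..})"
    and "((\<lambda>\<tau>. pairing (B \<tau>) (trig_wave (freq k) P Q)) has_vector_derivative
            - ((norm (freq k))\<^sup>2 *\<^sub>R pairing (B t) (trig_wave (freq k) P Q))
            - (b \<bullet> freq k) *\<^sub>R pairing (U t) (trig_wave (freq k) Q (- P))) (at t within {0..})"
proof -
  let ?\<phi> = "trig_wave (freq k) P Q"
  have "((\<lambda>\<tau>. pairing (U \<tau>) ?\<phi>) has_vector_derivative
           - pairing (B t) (\<lambda>x. b \<bullet> gradient ?\<phi> x)) (at t within {0..})"
    and "((\<lambda>\<tau>. pairing (B \<tau>) ?\<phi>) has_vector_derivative
           pairing (B t) (laplacian ?\<phi>) - pairing (U t) (\<lambda>x. b \<bullet> gradient ?\<phi> x)) (at t within {0..})"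
    using sol \<open>t \<ge> 0\<close> trig_wave_test unfolding linear_mhd_solution_def by blast+
  moreover have "laplacian ?\<phi> = (\<lambda>x. - (norm (freq k))\<^sup>2 * ?\<phi> x)"
    by (rule ext) (rule laplacian_trig_wave)
  moreover have "(\<lambda>x. b \<bullet> gradient ?\<phi> x) = (\<lambda>x. (b \<bullet> freq k) * trig_wave (freq k) Q (- P) x)"
    by (simp add: gradient_trig_wave mult.commute)
  ultimately show "((\<lambda>\<tau>. pairing (U \<tau>) ?\<phi>) has_vector_derivative
            - ((b \<bullet> freq k) *\<^sub>R pairing (B t) (trig_wave (freq k) Q (- P)))) (at t within {0..})"
    and "((\<lambda>\<tau>. pairing (B \<tau>) ?\<phi>) has_vector_derivative
            - ((norm (freq k))\<^sup>2 *\<^sub>R pairing (B t) ?\<phi>)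
            - (b \<bullet> freq k) *\<^sub>R pairing (U t) (trig_wave (freq k) Q (- P))) (at t within {0..})"
    by (simp_all only: pairing_cmult scaleR_minus_left)
qed

text \<open>The operator b \<bullet> \<nabla> exchanges cosine and sine, so each sine mode of one
  field couples only to the cosine mode of the other. The sign of the derivative of the cosine
  accounts for the opposite sign of a in the second pair.\<close>

lemma solution_damped_pairs:
  assumes sol: "linear_mhd_solution b U\<^sub>0 B\<^sub>0 U B"
  shows "damped_pair (b \<bullet> freq k) ((norm (freq k))\<^sup>2)
           (\<lambda>t. pairing (U t) (trig_wave (freq k) 0 1)) (\<lambda>t. pairing (B t) (trig_wave (freq k) 1 0))"
    and "damped_pair (- (b \<bullet> freq k)) ((norm (freq k))\<^sup>2)
           (\<lambda>t. pairing (U t) (trig_wave (freq k) 1 0)) (\<lambda>t. pairing (B t) (trig_wave (freq k) 0 1))"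
proof -
  let ?c = "trig_wave (freq k) 1 0" and ?s = "trig_wave (freq k) 0 1"
  have minus_sin: "pairing f (trig_wave (freq k) 0 (- 1)) = - pairing f ?s" for f
    using pairing_trig_wave_minus[of f "freq k" 0 1] by simp
  note cos_der = solution_mode_derivative[OF sol, where k = k and P = 1 and Q = 0, unfolded minus_sin]
  note sin_der = solution_mode_derivative[OF sol, where k = k and P = 0 and Q = 1, unfolded minus_zero]
  show "damped_pair (b \<bullet> freq k) ((norm (freq k))\<^sup>2) (\<lambda>t. pairing (U t) ?s) (\<lambda>t. pairing (B t) ?c)"
    unfolding damped_pair_def
  proof (intro conjI allI impI)
    fix t :: real assume "t \<ge> 0"
    show "((\<lambda>t. pairing (U t) ?s) has_vector_derivative
        (- (b \<bullet> freq k)) *\<^sub>R pairing (B t) ?c) (at t within {0..})"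
      using sin_der(1)[OF \<open>t \<ge> 0\<close>] by simp
    show "((\<lambda>t. pairing (B t) ?c) has_vector_derivative
        (b \<bullet> freq k) *\<^sub>R pairing (U t) ?s - (norm (freq k))\<^sup>2 *\<^sub>R pairing (B t) ?c) (at t within {0..})"
      using cos_der(2)[OF \<open>t \<ge> 0\<close>] by simp
  qed
  show "damped_pair (- (b \<bullet> freq k)) ((norm (freq k))\<^sup>2) (\<lambda>t. pairing (U t) ?c) (\<lambda>t. pairing (B t) ?s)"
    unfolding damped_pair_def
  proof (intro conjI allI impI)
    fix t :: real assume "t \<ge> 0"
    show "((\<lambda>t. pairing (U t) ?c) has_vector_derivative
        (- (- (b \<bullet> freq k))) *\<^sub>R pairing (B t) ?s) (at t within {0..})"
      using cos_der(1)[OF \<open>t \<ge> 0\<close>] by simp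
    have "- ((norm (freq k))\<^sup>2 *\<^sub>R pairing (B t) ?s) - (b \<bullet> freq k) *\<^sub>R pairing (U t) ?c
        = (- (b \<bullet> freq k)) *\<^sub>R pairing (U t) ?c - (norm (freq k))\<^sup>2 *\<^sub>R pairing (B t) ?s"
      by simp
    then show "((\<lambda>t. pairing (B t) ?s) has_vector_derivative
        (- (b \<bullet> freq k)) *\<^sub>R pairing (U t) ?c - (norm (freq k))\<^sup>2 *\<^sub>R pairing (B t) ?s) (at t within {0..})"
      using sin_der(2)[OF \<open>t \<ge> 0\<close>] by (simp only:)
  qed
qed

section \<open>Integrability on the period cell, and Fourier coefficients as pairings\<close>

lemma torus_cell_lmeasurable: "torus_cell \<in> lmeasurable"
  by (simp add: torus_cell_def)

lemma torus_L2_integrable: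
  assumes "f \<in> torus_L2"
  shows "integrable (lebesgue_on torus_cell) f"
proof -
  interpret finite_measure "lebesgue_on (torus_cell :: (real ^ 'n) set)"
    using torus_cell_lmeasurable by (rule finite_measure_lebesgue_on)
  have f: "f \<in> borel_measurable (lebesgue_on torus_cell)"
    and sq: "integrable (lebesgue_on torus_cell) (\<lambda>x. (norm (f x))\<^sup>2)"
    using assms by (simp_all add: torus_L2_def)
  have "integrable (lebesgue_on torus_cell) (\<lambda>x. norm (f x))"
    using measurable_compose[OF f borel_measurable_norm] sq by (rule square_integrable_imp_integrable)
  then show ?thesis
    using f by (rule integrable_norm_cancel)
qed

lemma borel_measurable_trig_wave: "trig_wave \<kappa> A B \<in> borel_measurable (lebesgue_on torus_cell)"
  using torus_cell_lmeasurable unfolding trig_wave_def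
  by (intro continuous_imp_measurable_on_sets_lebesgue continuous_intros) (auto simp: fmeasurable_def)

lemma integrable_trig_wave_mult:
  assumes "f \<in> torus_L2"
  shows "integrable (lebesgue_on torus_cell) (\<lambda>x. trig_wave \<kappa> A B x *\<^sub>R f x)"
proof (rule Bochner_Integration.integrable_bound)
  show "integrable (lebesgue_on torus_cell) (\<lambda>x. (\<bar>A\<bar> + \<bar>B\<bar>) *\<^sub>R f x)"
    using torus_L2_integrable[OF assms] by simp
  show "(\<lambda>x. trig_wave \<kappa> A B x *\<^sub>R f x) \<in> borel_measurable (lebesgue_on torus_cell)"
    using borel_measurable_trig_wave torus_L2_integrable[OF assms] by measurable
  have "\<bar>trig_wave \<kappa> A B x\<bar> \<le> \<bar>A\<bar> + \<bar>B\<bar>" for x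
  proof -
    have "\<bar>A * cos (\<kappa> \<bullet> x)\<bar> \<le> \<bar>A\<bar> * 1" "\<bar>B * sin (\<kappa> \<bullet> x)\<bar> \<le> \<bar>B\<bar> * 1"
      unfolding abs_mult by (intro mult_left_mono; simp)+
    then show ?thesis
      unfolding trig_wave_def by linarith
  qed
  then show "AE x in lebesgue_on torus_cell.
      norm (trig_wave \<kappa> A B x *\<^sub>R f x) \<le> norm ((\<bar>A\<bar> + \<bar>B\<bar>) *\<^sub>R f x)"
    by (intro AE_I2) (simp add: mult_right_mono)
qed

lemma pairing_trig_wave_nth:
  assumes "f \<in> torus_L2"
  shows "integrable (lebesgue_on torus_cell) (\<lambda>x. trig_wave \<kappa> A B x * f x $ i)"
    and "pairing f (trig_wave \<kappa> A B) $ i = (LINT x|lebesgue_on torus_cell. trig_wave \<kappa> A B x * f x $ i)"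
  using integrable_bounded_linear[OF bounded_linear_vec_nth integrable_trig_wave_mult[OF assms]]
    integral_bounded_linear[OF bounded_linear_vec_nth integrable_trig_wave_mult[OF assms]]
  by (simp_all add: pairing_def)

lemma fourier_coeff_nth:
  fixes f :: "real ^ 'n::finite \<Rightarrow> real ^ 'n"
  assumes "f \<in> torus_L2"
  shows "fourier_coeff f k $ i =
    Complex (pairing f (trig_wave (freq k) 1 0) $ i) (- pairing f (trig_wave (freq k) 0 1) $ i)
      / (2 * pi) ^ CARD('n)"
proof -
  let ?M = "lebesgue_on (torus_cell :: (real ^ 'n) set)"
  let ?c = "\<lambda>x. trig_wave (freq k) 1 0 x * f x $ i" and ?s = "\<lambda>x. trig_wave (freq k) 0 1 x * f x $ i"
  have "complex_of_real (f x $ i) * cis (- (freq k \<bullet> x))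
      = complex_of_real (?c x) - \<i> * complex_of_real (?s x)" for x
    by (simp add: complex_eq_iff trig_wave_def)
  then have "(LINT x|?M. complex_of_real (f x $ i) * cis (- (freq k \<bullet> x)))
      = complex_of_real (LINT x|?M. ?c x) - \<i> * complex_of_real (LINT x|?M. ?s x)"
    using pairing_trig_wave_nth(1)[OF assms, of "freq k" 1 0 i]
      pairing_trig_wave_nth(1)[OF assms, of "freq k" 0 1 i]
    by (simp del: of_real_mult)
  then show ?thesis
    by (simp add: fourier_coeff_def pairing_trig_wave_nth(2)[OF assms] Complex_eq)
qed

text \<open>Since f is real, its cosine and sine pairings are, up to sign and normalisation, the
  real and imaginary parts of the coefficient. This links the Sobolev norms to the real damped
  pairs.\<close>

lemma norm_fourier_coeff:
  fixes f :: "real ^ 'n::finite \<Rightarrow> real ^ 'n"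
  assumes "f \<in> torus_L2"
  shows "(norm (fourier_coeff f k))\<^sup>2 =
    ((norm (pairing f (trig_wave (freq k) 1 0)))\<^sup>2 + (norm (pairing f (trig_wave (freq k) 0 1)))\<^sup>2)
      / ((2 * pi) ^ CARD('n))\<^sup>2"
proof -
  have norm_sq: "(norm x)\<^sup>2 = (\<Sum>i\<in>UNIV. (norm (x $ i))\<^sup>2)" for x :: "'b::real_normed_vector ^ 'n"
    by (simp add: norm_vec_def L2_set_def sum_nonneg)
  have "(norm (fourier_coeff f k $ i))\<^sup>2 =
      ((pairing f (trig_wave (freq k) 1 0) $ i)\<^sup>2 + (pairing f (trig_wave (freq k) 0 1) $ i)\<^sup>2)
        / ((2 * pi) ^ CARD('n))\<^sup>2" for i
    unfolding fourier_coeff_nth[OF assms]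
    by (simp add: norm_divide norm_power norm_mult power_divide cmod_power2)
  then show ?thesis
    unfolding norm_sq[of "fourier_coeff f k"] norm_sq[of "pairing f _"]
    by (simp add: sum.distrib sum_divide_distrib add_divide_distrib)
qed

text \<open>The solution attains its data only almost everywhere; this transfers the modes at time 0
  to those of the data.\<close>

lemma pairing_cong_AE:
  assumes "f \<in> torus_L2" "g \<in> torus_L2" "AE x in lebesgue_on torus_cell. f x = g x"
  shows "pairing f (trig_wave \<kappa> A B) = pairing g (trig_wave \<kappa> A B)"
  unfolding pairing_def
proof (rule integral_cong_AE)
  show "AE x in lebesgue_on torus_cell. trig_wave \<kappa> A B x *\<^sub>R f x = trig_wave \<kappa> A B x *\<^sub>R g x"
    using assms(3) by eventually_elim simp
qed (use borel_measurable_integrable[OF integrable_trig_wave_mult] assms in blast)+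

section \<open>Zero mode, Diophantine rate and summation over the frequencies\<close>

lemma freq_zero [simp]: "freq 0 = 0"
  by (simp add: freq_def vec_eq_iff)

lemma norm_freq_ge_one:
  assumes "k \<noteq> 0"
  shows "norm (freq k) \<ge> 1"
proof -
  from assms obtain i where "k $ i \<noteq> 0"
    by (auto simp: vec_eq_iff)
  then have "1 \<le> \<bar>freq k $ i\<bar>"
    by (simp add: freq_def flip: of_int_abs)
  also have "\<dots> \<le> norm (freq k)"
    by (rule component_le_norm_cart)
  finally show ?thesis .
qed

text \<open>At k = 0 both the coupling and the damping vanish, so the means are conserved and do not
  decay. The mean-zero data remove this mode.\<close>

lemma solution_zero_mode:
  assumes sol: "linear_mhd_solution b U\<^sub>0 B\<^sub>0 U B" and "t \<ge> 0"
  shows "pairing (U t) (trig_wave 0 P Q) = pairing (U 0) (trig_wave 0 P Q)"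
    and "pairing (B t) (trig_wave 0 P Q) = pairing (B 0) (trig_wave 0 P Q)"
proof -
  have const: "f t = f 0"
    if d: "\<And>x. x \<ge> 0 \<Longrightarrow> (f has_vector_derivative 0) (at x within {0..})"
    for f :: "real \<Rightarrow> real ^ 'n"
  proof -
    obtain c where "\<And>x. x \<in> {0..} \<Longrightarrow> f x = c"
      using has_vector_derivative_zero_constant[of "{0..}" f] d by auto
    then show ?thesis
      using \<open>t \<ge> 0\<close> by simp
  qed
  show "pairing (U t) (trig_wave 0 P Q) = pairing (U 0) (trig_wave 0 P Q)"
    using solution_mode_derivative(1)[OF sol, where k = 0 and P = P and Q = Q]
    by (intro const) simp
  show "pairing (B t) (trig_wave 0 P Q) = pairing (B 0) (trig_wave 0 P Q)"
    using solution_mode_derivative(2)[OF sol, where k = 0 and P = P and Q = Q]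
    by (intro const) simp
qed

text \<open>Summability comes first, by comparison: without it \<open>infsum\<close> could take its
  default value 0 and the norm bound would say nothing.\<close>

lemma sobolev_norm_le_of_terms:
  assumes f: "f \<in> torus_L2" and "g \<in> sobolev m" "h \<in> sobolev m" and "G \<ge> 0"
    and le: "\<And>k. sobolev_term s f k \<le> G\<^sup>2 * (sobolev_term m g k + sobolev_term m h k)"
  shows "f \<in> sobolev s \<and> sobolev_norm s f \<le> G * sobolev_norm_pair m g h"
proof -
  have nonneg: "sobolev_term \<sigma> \<phi> k \<ge> 0" for \<sigma> k and \<phi> :: "real ^ 'a \<Rightarrow> real ^ 'a"
    by (simp add: sobolev_term_def)
  have gh: "sobolev_term m g summable_on UNIV" "sobolev_term m h summable_on UNIV"
    using assms by (auto simp: sobolev_def)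
  then have sum: "(\<lambda>k. G\<^sup>2 * (sobolev_term m g k + sobolev_term m h k)) summable_on UNIV"
    by (intro summable_on_cmult_right summable_on_add)
  then have f_sum: "sobolev_term s f summable_on UNIV"
    by (rule summable_on_comparison_test) (use le nonneg in auto)
  have "infsum (sobolev_term s f) UNIV \<le> (\<Sum>\<^sub>\<infinity>k. G\<^sup>2 * (sobolev_term m g k + sobolev_term m h k))"
    using f_sum sum le by (rule infsum_mono)
  also have "\<dots> = G\<^sup>2 * (infsum (sobolev_term m g) UNIV + infsum (sobolev_term m h) UNIV)"
    using gh by (simp add: infsum_cmult_right' infsum_add)
  also have "\<dots> = (G * sobolev_norm_pair m g h)\<^sup>2"
    by (simp add: power_mult_distrib sobolev_norm_pair_def sobolev_norm_def infsum_nonneg nonneg)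
  finally have "sobolev_norm s f \<le> sqrt ((G * sobolev_norm_pair m g h)\<^sup>2)"
    unfolding sobolev_norm_def by (rule real_sqrt_le_mono)
  also have "\<dots> = G * sobolev_norm_pair m g h"
    using \<open>G \<ge> 0\<close> by (simp add: sobolev_norm_pair_def)
  finally show ?thesis
    using f f_sum by (simp add: sobolev_def)
qed

text \<open>Squaring the Diophantine bound and dividing by the square of the frequency gives the
  exponent -2 (1 + r). Passing to 1 plus that square, the Sobolev weight, only lowers a power with
  nonpositive exponent.\<close>

lemma diophantine_rate:
  fixes k :: "int ^ 'n::finite"
  assumes "c > 0" "r \<ge> -1" "k \<noteq> 0" and dio: "\<bar>b \<bullet> freq k\<bar> \<ge> c * norm (freq k) powr (- r)"
  shows "(b \<bullet> freq k)\<^sup>2 / (norm (freq k))\<^sup>2 \<ge> c\<^sup>2 * (1 + (norm (freq k))\<^sup>2) powr (- (1 + r))"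
proof -
  define N where "N = norm (freq k)"
  have "N \<ge> 1"
    unfolding N_def using \<open>k \<noteq> 0\<close> by (rule norm_freq_ge_one)
  have "(1 + N\<^sup>2) powr (- (1 + r)) \<le> (N\<^sup>2) powr (- (1 + r))"
    using \<open>N \<ge> 1\<close> \<open>r \<ge> -1\<close> by (intro powr_mono2') auto
  also have "\<dots> = (N powr (- r))\<^sup>2 / N\<^sup>2"
  proof -
    have "(N\<^sup>2) powr (- (1 + r)) = N powr (2 * (- r) + - 2)"
      using \<open>N \<ge> 1\<close> by (simp add: powr_powr algebra_simps flip: powr_numeral)
    also have "\<dots> = N powr (2 * (- r)) * N powr (- 2)"
      by (rule powr_add)
    also have "N powr (2 * (- r)) = (N powr (- r))\<^sup>2"
      using \<open>N \<ge> 1\<close> by (simp add: powr_powr mult.commute flip: powr_numeral)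
    also have "N powr (- 2) = 1 / N\<^sup>2"
      using \<open>N \<ge> 1\<close> by (simp add: powr_minus_divide)
    finally show ?thesis by simp
  qed
  finally have "c\<^sup>2 * (1 + N\<^sup>2) powr (- (1 + r)) \<le> (c * N powr (- r))\<^sup>2 / N\<^sup>2"
    by (simp add: power_mult_distrib mult_left_mono flip: times_divide_eq_right)
  also have "\<dots> \<le> \<bar>b \<bullet> freq k\<bar>\<^sup>2 / N\<^sup>2"
    using dio \<open>c > 0\<close> by (intro divide_right_mono power_mono) (auto simp: N_def)
  finally show ?thesis
    by (simp add: N_def)
qed

theorem theorem1p2:
  fixes b :: "real ^ 'n" and r m s :: real
  assumes "CARD('n) \<ge> 2"
    and "r > real CARD('n) - 1"
    and "diophantine r b"
    and "m \<ge> 0"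
    and "s \<in> {0..m}"
  shows "\<exists>C>0. \<forall>U\<^sub>0 B\<^sub>0 U B.
           U\<^sub>0 \<in> sobolev m \<and> B\<^sub>0 \<in> sobolev m \<and>
           (LINT x|lebesgue_on torus_cell. U\<^sub>0 x) = 0 \<and>
           (LINT x|lebesgue_on torus_cell. B\<^sub>0 x) = 0 \<and>
           linear_mhd_solution b U\<^sub>0 B\<^sub>0 U B \<longrightarrow>
           (\<forall>t\<ge>0.
              U t \<in> sobolev s \<and>
              sobolev_norm s (U t)
                \<le> C * (1 + t) powr (- ((m - s) / (2 * (1 + r)))) * sobolev_norm_pair m U\<^sub>0 B\<^sub>0 \<and>
              B t \<in> sobolev s \<and>
              sobolev_norm s (B t)
                \<le> C * (1 + t) powr (- (1 / 2 + (m - s + 1) / (2 * (1 + r))))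
                    * sobolev_norm_pair m U\<^sub>0 B\<^sub>0)"
proof -
  have "r \<ge> -1"
    using assms(2) by (simp add: order.trans[OF _ less_imp_le])
  have "1 + r > 0"
    using assms(1,2) by linarith
  have "s \<le> m"
    using assms(5) by simp
  obtain c where "c > 0" and dio: "\<And>k::int ^ 'n. k \<noteq> 0 \<Longrightarrow> \<bar>b \<bullet> freq k\<bar> \<ge> c * norm (freq k) powr (- r)"
    using assms(3) by (auto simp: diophantine_def)
  \<comment> \<open>The mode estimates concern squares: their exponents are twice \<open>dU\<close>
    and \<open>dB\<close>, and the final constant is \<open>sqrt C\<close>.\<close>
  define dU where "dU = (m - s) / (2 * (1 + r))"
  define dB where "dB = 1 / 2 + (m - s + 1) / (2 * (1 + r))"
  have dU: "(m - s) / (1 + r) = 2 * dU" and dB: "1 + (m - s + 1) / (1 + r) = 2 * dB"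
    using \<open>1 + r > 0\<close> by (simp_all add: dU_def dB_def field_simps)
  \<comment> \<open>K is the square of the norm of b, by Cauchy-Schwarz; the Diophantine rate
    supplies \<open>c\<^sup>2\<close> and p = 1 + r.\<close>
  from damped_pair_sobolev_decay[where ?'a = "real ^ 'n", of "(norm b)\<^sup>2" "c\<^sup>2" "1 + r" s m]
  obtain C where "C > 0" and decay: "\<And>a l (u :: real \<Rightarrow> real ^ 'n) w t.
      damped_pair a l u w \<Longrightarrow> l \<ge> 1 \<Longrightarrow> a\<^sup>2 \<le> (norm b)\<^sup>2 * l \<Longrightarrow>
      a\<^sup>2 / l \<ge> c\<^sup>2 * (1 + l) powr (- (1 + r)) \<Longrightarrow> t \<ge> 0 \<Longrightarrow>
        (1 + l) powr s * (norm (u t))\<^sup>2 \<le> C * (1 + t) powr (- (2 * dU))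
            * ((1 + l) powr m * ((norm (u 0))\<^sup>2 + (norm (w 0))\<^sup>2)) \<and>
        (1 + l) powr s * (norm (w t))\<^sup>2 \<le> C * (1 + t) powr (- (2 * dB))
            * ((1 + l) powr m * ((norm (u 0))\<^sup>2 + (norm (w 0))\<^sup>2))"
    unfolding dU dB using \<open>c > 0\<close> \<open>1 + r > 0\<close> \<open>s \<le> m\<close> by auto
  have main: "U t \<in> sobolev s \<and> sobolev_norm s (U t)
          \<le> sqrt C * (1 + t) powr (- dU) * sobolev_norm_pair m U\<^sub>0 B\<^sub>0 \<and>
      B t \<in> sobolev s \<and> sobolev_norm s (B t)
          \<le> sqrt C * (1 + t) powr (- dB) * sobolev_norm_pair m U\<^sub>0 B\<^sub>0"
    if U0: "U\<^sub>0 \<in> sobolev m" and B0: "B\<^sub>0 \<in> sobolev m"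
      and mean: "(LINT x|lebesgue_on torus_cell. U\<^sub>0 x) = 0" "(LINT x|lebesgue_on torus_cell. B\<^sub>0 x) = 0"
      and sol: "linear_mhd_solution b U\<^sub>0 B\<^sub>0 U B" and "t \<ge> 0"
    for U\<^sub>0 B\<^sub>0 U B and t :: real
  proof -
    have L2: "U\<^sub>0 \<in> torus_L2" "B\<^sub>0 \<in> torus_L2" "\<And>\<tau>. \<tau> \<ge> 0 \<Longrightarrow> U \<tau> \<in> torus_L2"
      "\<And>\<tau>. \<tau> \<ge> 0 \<Longrightarrow> B \<tau> \<in> torus_L2"
      using U0 B0 sol by (auto simp: sobolev_def linear_mhd_solution_def)
    have "AE x in lebesgue_on torus_cell. U 0 x = U\<^sub>0 x" "AE x in lebesgue_on torus_cell. B 0 x = B\<^sub>0 x"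
      using sol by (auto simp: linear_mhd_solution_def)
    then have init: "pairing (U 0) (trig_wave \<kappa> P Q) = pairing U\<^sub>0 (trig_wave \<kappa> P Q)"
      "pairing (B 0) (trig_wave \<kappa> P Q) = pairing B\<^sub>0 (trig_wave \<kappa> P Q)" for \<kappa> P Q
      using L2 by (auto intro: pairing_cong_AE)
    define V where "V = ((2 * pi) ^ CARD('n))\<^sup>2"
    have "V > 0" by (simp add: V_def)
    note coeff = norm_fourier_coeff[where ?'n = 'n, folded V_def]
    have terms: "sobolev_term s (U t) k \<le> (sqrt C * (1 + t) powr (- dU))\<^sup>2
          * (sobolev_term m U\<^sub>0 k + sobolev_term m B\<^sub>0 k) \<and>
        sobolev_term s (B t) k \<le> (sqrt C * (1 + t) powr (- dB))\<^sup>2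
          * (sobolev_term m U\<^sub>0 k + sobolev_term m B\<^sub>0 k)" for k
    proof (cases "k = 0")
      case True
      \<comment> \<open>At frequency 0 the wave is the constant P, so these pairings are multiples
        of the means.\<close>
      have "pairing U\<^sub>0 (trig_wave 0 P Q) = 0" "pairing B\<^sub>0 (trig_wave 0 P Q) = 0" for P Q
        using mean by (simp_all add: pairing_def trig_wave_def)
      then show ?thesis
        using True L2 \<open>t \<ge> 0\<close>
        by (simp add: sobolev_term_def coeff solution_zero_mode[OF sol \<open>t \<ge> 0\<close>] init)
    next
      case False
      define l where "l = (norm (freq k))\<^sup>2"
      have "l \<ge> 1"
        using norm_freq_ge_one[OF False] by (simp add: l_def)
      have bl: "(b \<bullet> freq k)\<^sup>2 \<le> (norm b)\<^sup>2 * l"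
        using Cauchy_Schwarz_ineq[of b "freq k"] by (simp add: l_def power2_norm_eq_inner)
      have rate: "(b \<bullet> freq k)\<^sup>2 / l \<ge> c\<^sup>2 * (1 + l) powr (- (1 + r))"
        unfolding l_def using \<open>c > 0\<close> \<open>r \<ge> -1\<close> False dio[OF False] by (rule diophantine_rate)
      have sq: "(sqrt C * (1 + t) powr (- d))\<^sup>2 = C * (1 + t) powr (- (2 * d))" for d
        using \<open>C > 0\<close> by (simp add: power_mult_distrib power2_eq_square[of "_ powr _"] flip: powr_add)
      let ?c = "trig_wave (freq k) 1 0" and ?s = "trig_wave (freq k) 0 1"
      let ?E = "(norm (pairing U\<^sub>0 ?c))\<^sup>2 + (norm (pairing U\<^sub>0 ?s))\<^sup>2
              + ((norm (pairing B\<^sub>0 ?c))\<^sup>2 + (norm (pairing B\<^sub>0 ?s))\<^sup>2)"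
      note pairs = solution_damped_pairs[OF sol, of k, folded l_def]
      note d1 = decay[OF pairs(1) \<open>l \<ge> 1\<close> bl rate \<open>t \<ge> 0\<close>, unfolded init]
      have bl': "(- (b \<bullet> freq k))\<^sup>2 \<le> (norm b)\<^sup>2 * l"
        and rate': "(- (b \<bullet> freq k))\<^sup>2 / l \<ge> c\<^sup>2 * (1 + l) powr (- (1 + r))"
        using bl rate by simp_all
      note d2 = decay[OF pairs(2) \<open>l \<ge> 1\<close> bl' rate' \<open>t \<ge> 0\<close>, unfolded init]
      \<comment> \<open>Each pair holds one phase of each field; adding the two estimates yields
        both phases of \<open>U\<close> and of \<open>B\<close> against the full initial mode energy
        \<open>?E\<close>.\<close>
      have "(1 + l) powr s * ((norm (pairing (U t) ?c))\<^sup>2 + (norm (pairing (U t) ?s))\<^sup>2)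
          \<le> C * (1 + t) powr (- (2 * dU)) * ((1 + l) powr m * ?E)"
        and "(1 + l) powr s * ((norm (pairing (B t) ?c))\<^sup>2 + (norm (pairing (B t) ?s))\<^sup>2)
          \<le> C * (1 + t) powr (- (2 * dB)) * ((1 + l) powr m * ?E)"
        using add_mono[OF conjunct1[OF d1] conjunct1[OF d2]] add_mono[OF conjunct2[OF d1] conjunct2[OF d2]]
        by (simp_all add: algebra_simps)
      \<comment> \<open>The normalisation V of the Fourier coefficients occurs on both sides and
        cancels.\<close>
      moreover have "x * (y / V) \<le> D * (M * (e / V) + M * (f / V))" if "x * y \<le> D * (M * (e + f))"
        for x y D M e f :: real
        using divide_right_mono[OF that, of V] \<open>V > 0\<close> by (simp add: add_divide_distrib distrib_left)
      ultimately show ?thesis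
        unfolding sobolev_term_def sq l_def[symmetric] coeff[OF L2(1)] coeff[OF L2(2)]
          coeff[OF L2(3)[OF \<open>t \<ge> 0\<close>]] coeff[OF L2(4)[OF \<open>t \<ge> 0\<close>]]
        by simp
    qed
    show ?thesis
      using sobolev_norm_le_of_terms[OF L2(3)[OF \<open>t \<ge> 0\<close>] U0 B0, of "sqrt C * (1 + t) powr (- dU)" s]
        sobolev_norm_le_of_terms[OF L2(4)[OF \<open>t \<ge> 0\<close>] U0 B0, of "sqrt C * (1 + t) powr (- dB)" s]
        terms \<open>C > 0\<close> by simp
  qed
  show ?thesis
    using main \<open>C > 0\<close> unfolding dU_def dB_def by (intro exI[of _ "sqrt C"]) auto
qed

end
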